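(* The following are equivalent. (1) The ideals $I_{\mathcal A}$ and $I_{\mathcal C_{\mathcal A}}$ are not equal. (2) There is a generic $\omega\in\mathbb{R}^n$ for which $\mathcal A$ has a CSP polytope. (3) For every generic $\omega\in\mathbb{R}^n$, $\mathcal A$ has a CSP polytope.
   Context: Setting: $\mathcal A=\{\mathbf a_1,\dots,\mathbf a_n\}\subset\mathbb{Z}^d$ is an ordered vector configuration such that the $d\times n$ matrix $A=[\mathbf a_1\cdots\mathbf a_n]$ has rank $d$; $\mathcal L_{\mathcal A}=\{\mathbf u\in\mathbb{Z}^n: A\mathbf u=\mathbf 0\}$, and it is assumed that $\mathcal L_{\mathcal A}\cap\mathbb{N}^n=\{\mathbf 0\}$ ($\mathbb N$ contains $0$). $\mathbf k$ is an algebraically closed field, $\mathbf k[\mathbf x]=\mathbf k[x_1,\dots,x_n]$, $[n]=\{1,\dots,n\}$. For $\mathbf u\in\mathbb{Z}^n$: $\mathrm{supp}(\mathbf u)=\{i:u_i\ne0\}$, $\mathbf u^+_i=\max(u_i,0)$, $\mathbf u^-_i=\max(-u_i,0)$. Circuit: a non-zero vector $\mathbf c\in\mathcal L_{\mathcal A}$ whose entries have greatest common divisor one and such that no non-zero $\mathbf d\in\mathcal L_{\mathcal A}$ has $\mathrm{supp}(\mathbf d)\subsetneq\mathrm{supp}(\mathbf c)$. Circuit ideal: $I_{\mathcal C_{\mathcal A}}=\langle\mathbf x^{\mathbf c^+}-\mathbf x^{\mathbf c^-}:\mathbf c\text{ a circuit}\rangle$. Toric ideal: $I_{\mathcal A}=\langle\mathbf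 x^{\mathbf u^+}-\mathbf x^{\mathbf u^-}:\mathbf u\in\mathcal L_{\mathcal A}\rangle$. Initial ideals: for $\omega\in\mathbb{R}^n$, $\mathrm{in}_\omega(f)$ is the sum of the terms $c\,\mathbf x^{\mathbf u}$ of $f$ with $\omega\cdot\mathbf u$ maximal, and $\mathrm{in}_\omega(I)=\langle\mathrm{in}_\omega(f):f\in I\rangle$. $\omega$ is generic if $\mathrm{in}_\omega(I_{\mathcal A})$ and $\mathrm{in}_\omega(I_{\mathcal C_{\mathcal A}})$ are both monomial ideals. Standard pairs: a standard monomial of a monomial ideal $M$ is a monomial not in $M$. For a standard monomial $\mathbf x^{\mathbf u}$ and $\sigma\subseteq[n]$, $(\mathbf x^{\mathbf u},\sigma)$ is an admissible pair of $M$ if $\mathrm{supp}(\mathbf u)\cap\sigma=\emptyset$ and all monomials in $\mathbf x^{\mathbf u}\cdot\mathbf k[x_j:j\in\sigma]$ are standard. It is a standard pair if there is no other admissible pair $(\mathbf x^{\mathbf v},\tau)$ with $\mathbf v\le\mathbf u$ and $\mathrm{supp}(\mathbf u-\mathbf v)\cup\sigma\subseteq\tau$. CSP: for generic $\omega$, a circuit-specific standard pair (CSP) of $\mathrm{in}_\omega(I_{\mathcal C_{\mathcal A}})$ is a standard pair of $\mathrm{in}_\omega(I_{\mathcal C_{\mathcal A}})$ that is not a standard pair of $\mathrm{in}_\omega(I_{\mathcal A})$. CSP polytope: fix $B\in\mathbb{Z}^{n\times(n-d)}$ whose columns form a basis of the lattice $\mathcal L_{\mathcal A}$. For $\mathbf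 u\in\mathbb{N}^n$ and $\sigma\subseteq[n]$, with $\bar\sigma=[n]\setminus\sigma$, let $Q_{\mathbf u,\omega}^{\bar\sigma}=\{\mathbf z\in\mathbb{R}^{n-d}:(B\mathbf z\le\mathbf u)^{\bar\sigma},\ (-\omega B)\mathbf z\le0\}$, where $(B\mathbf z\le\mathbf u)^{\bar\sigma}$ is the subsystem of inequalities indexed by $\bar\sigma$. A CSP polytope of $\mathcal A$ (with respect to generic $\omega$) is a polytope $Q_{\mathbf u,\omega}^{\bar\sigma}$ where $(\mathbf x^{\mathbf u},\sigma)$ is a CSP of $\mathrm{in}_\omega(I_{\mathcal C_{\mathcal A}})$. *)

theory Defs
  imports
    "HOL-Analysis.Polytope"
    "HOL-Analysis.Cartesian_Space"
    "HOL-Analysis.Finite_Function_Topology"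
    "HOL-Computational_Algebra.Polynomial"
begin

text \<open>
  The configuration \<open>a_1, ..., a_n\<close> is the matrix \<open>A :: int^'n^'d\<close> with these vectors as
  columns. The index set \<open>[n]\<close> is the type \<open>'n\<close>, so that \<open>n\<close> is \<open>CARD('n)\<close> and \<open>d\<close> is
  \<open>CARD('d)\<close>.
\<close>

definition kernel_lattice :: "int^'n^'d \<Rightarrow> (int^'n) set" where
  "kernel_lattice A = {u. A *v u = 0}"

definition supp :: "'a::zero^'n \<Rightarrow> 'n set" where
  "supp u = {i. u $ i \<noteq> 0}"

definition pos_part :: "int^'n \<Rightarrow> nat^'n" where
  "pos_part u = (\<chi> i. nat (max (u $ i) 0))"

definition neg_part :: "int^'n \<Rightarrow> nat^'n" where
  "neg_part u = (\<chi> i. nat (max (- (u $ i)) 0))"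

definition circuit :: "int^'n^'d \<Rightarrow> int^'n \<Rightarrow> bool" where
  "circuit A c \<longleftrightarrow> c \<noteq> 0 \<and> c \<in> kernel_lattice A \<and> Gcd (range (\<lambda>i. c $ i)) = 1 \<and>
     \<not> (\<exists>d \<in> kernel_lattice A. d \<noteq> 0 \<and> supp d \<subset> supp c)"

text \<open>
  The polynomial ring \<open>k[x_1, ..., x_n]\<close> is the monoid algebra of the exponent vectors:
  multiplication on \<open>\<Rightarrow>\<^sub>0\<close> is convolution.
\<close>

type_synonym ('n, 'k) mpoly = "(nat, 'n) vec \<Rightarrow>\<^sub>0 'k"

definition xmonom :: "nat^'n \<Rightarrow> ('n, 'k::field) mpoly" where
  "xmonom u = Poly_Mapping.single u 1"

text \<open>The ideal generated by \<open>S\<close>: the span of \<open>S\<close> in the ring as a module over itself.\<close>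

definition ideal_gen :: "'r::comm_ring_1 set \<Rightarrow> 'r set" where
  "ideal_gen S = module.span (*) S"

definition circuit_ideal :: "int^'n^'d \<Rightarrow> ('n, 'k::field) mpoly set" where
  "circuit_ideal A = ideal_gen {xmonom (pos_part c) - xmonom (neg_part c) | c. circuit A c}"

definition toric_ideal :: "int^'n^'d \<Rightarrow> ('n, 'k::field) mpoly set" where
  "toric_ideal A =
     ideal_gen {xmonom (pos_part u) - xmonom (neg_part u) | u. u \<in> kernel_lattice A}"

definition weight :: "real^'n \<Rightarrow> nat^'n \<Rightarrow> real" where
  "weight w u = (\<Sum>i\<in>UNIV. w $ i * real (u $ i))"

definition initial_form :: "real^'n \<Rightarrow> ('n, 'k::field) mpoly \<Rightarrow> ('n, 'k) mpoly" where
  "initial_form w f =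
     (\<Sum>u \<in> {u \<in> Poly_Mapping.keys f. \<forall>v \<in> Poly_Mapping.keys f. weight w v \<le> weight w u}.
        Poly_Mapping.single u (Poly_Mapping.lookup f u))"

definition initial_ideal :: "real^'n \<Rightarrow> ('n, 'k::field) mpoly set \<Rightarrow> ('n, 'k) mpoly set" where
  "initial_ideal w I = ideal_gen (initial_form w ` I)"

definition monomial_ideal :: "('n::finite, 'k::field) mpoly set \<Rightarrow> bool" where
  "monomial_ideal M \<longleftrightarrow> (\<exists>U. M = ideal_gen (xmonom ` U))"

text \<open>
  The coefficient field occurs in neither \<open>A\<close> nor \<open>\<omega>\<close>, so the notions that depend on it through
  the ideals take it as an explicit type argument.
\<close>

definition generic :: "'k::field itself \<Rightarrow> int^'n^'d \<Rightarrow> real^'n \<Rightarrow> bool" where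
  "generic k A w \<longleftrightarrow>
     monomial_ideal (initial_ideal w (toric_ideal A :: ('n, 'k) mpoly set)) \<and>
     monomial_ideal (initial_ideal w (circuit_ideal A :: ('n, 'k) mpoly set))"

definition admissible_pair ::
    "('n::finite, 'k::field) mpoly set \<Rightarrow> nat^'n \<Rightarrow> 'n set \<Rightarrow> bool" where
  "admissible_pair M u \<sigma> \<longleftrightarrow> xmonom u \<notin> M \<and> supp u \<inter> \<sigma> = {} \<and>
     (\<forall>v. supp v \<subseteq> \<sigma> \<longrightarrow> xmonom u * xmonom v \<notin> M)"

definition standard_pair ::
    "('n::finite, 'k::field) mpoly set \<Rightarrow> nat^'n \<Rightarrow> 'n set \<Rightarrow> bool" where
  "standard_pair M u \<sigma> \<longleftrightarrow> admissible_pair M u \<sigma> \<and>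
     \<not> (\<exists>v \<tau>. (v, \<tau>) \<noteq> (u, \<sigma>) \<and> admissible_pair M v \<tau> \<and> v \<le> u \<and> supp (u - v) \<union> \<sigma> \<subseteq> \<tau>)"

definition csp ::
    "'k::field itself \<Rightarrow> int^'n^'d \<Rightarrow> real^'n \<Rightarrow> nat^'n \<Rightarrow> 'n set \<Rightarrow> bool" where
  "csp k A w u \<sigma> \<longleftrightarrow>
     standard_pair (initial_ideal w (circuit_ideal A :: ('n, 'k) mpoly set)) u \<sigma> \<and>
     \<not> standard_pair (initial_ideal w (toric_ideal A :: ('n, 'k) mpoly set)) u \<sigma>"

text \<open>
  The number \<open>m = n - d\<close> of columns of \<open>B\<close> may be \<open>0\<close>, so it is not the size of a type.
  The columns of \<open>B\<close> are \<open>B 0, ..., B (m - 1)\<close> (the other values of \<open>B\<close> are irrelevant), and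
  \<open>\<real>\<^sup>m\<close> is the space of finitely supported functions \<open>z :: nat \<Rightarrow>\<^sub>0 real\<close> with
  support in \<open>{..<m}\<close>, a subspace of a real vector space.
\<close>

definition lattice_basis :: "nat \<Rightarrow> (nat \<Rightarrow> int^'n) \<Rightarrow> (int^'n) set \<Rightarrow> bool" where
  "lattice_basis m B L \<longleftrightarrow>
     L = {(\<Sum>j<m. c j *s B j) | c :: nat \<Rightarrow> int. True} \<and>
     (\<forall>c :: nat \<Rightarrow> int. (\<Sum>j<m. c j *s B j) = 0 \<longrightarrow> (\<forall>j<m. c j = 0))"

text \<open>The set \<open>Q\<close> for \<open>u\<close>, \<open>\<omega>\<close> and the set \<open>R\<close> of the rows of \<open>B z \<le> u\<close> that are kept.\<close>

definition Q_set ::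
    "nat \<Rightarrow> (nat \<Rightarrow> int^'n) \<Rightarrow> nat^'n \<Rightarrow> real^'n \<Rightarrow> 'n set \<Rightarrow> (nat \<Rightarrow>\<^sub>0 real) set" where
  "Q_set m B u w R = {z. Poly_Mapping.keys z \<subseteq> {..<m} \<and>
     (\<forall>i\<in>R. (\<Sum>j<m. real_of_int (B j $ i) * Poly_Mapping.lookup z j) \<le> real (u $ i)) \<and>
     (\<Sum>j<m. - (\<Sum>i\<in>UNIV. w $ i * real_of_int (B j $ i)) * Poly_Mapping.lookup z j) \<le> 0}"

definition csp_polytope ::
    "'k::field itself \<Rightarrow> int^'n^'d \<Rightarrow> (nat \<Rightarrow> int^'n) \<Rightarrow> real^'n \<Rightarrow>
     (nat \<Rightarrow>\<^sub>0 real) set \<Rightarrow> bool" where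
  "csp_polytope k A B w Q \<longleftrightarrow> polytope Q \<and>
     (\<exists>u \<sigma>. csp k A w u \<sigma> \<and> Q = Q_set (CARD('n) - CARD('d)) B u w (- \<sigma>))"

end

theory Submission
  imports
    Defs
    "HOL-Analysis.Kronecker_Approximation_Theorem"
    "HOL-Analysis.Equivalence_Lebesgue_Henstock_Integration"
begin

text \<open>
  If the toric ideal equals the circuit ideal, their initial ideals have the same standard pairs and
  no CSP exists. So everything rests on two facts: a generic weight exists, and for every generic
  weight \<open>\<omega>\<close> a difference between the ideals produces a CSP whose set \<open>Q\<close> is a polytope.

  For the first fact, choose \<open>\<omega>\<close> off the countably many hyperplanes orthogonal to nonzero integral
  vectors. Distinct monomials then have distinct weights, and every initial form is a single term
  (\<open>exists_weight_injective\<close>, \<open>monomial_initial_ideal\<close>).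

  For the second, both ideals are graded by the multidegree \<open>s \<mapsto> A s\<close>, whose fibers in
  \<open>\<nat>\<^sup>n\<close> are finite because the lattice meets the nonnegative orthant only in \<open>0\<close>. In a finite
  fiber, a homogeneous element of the toric ideal can be reduced modulo the circuit ideal as long as
  the initial ideals agree, so equal initial ideals force equal ideals
  (\<open>homogeneous_in_ideal_if_initial_ideal_le\<close>). If the ideals differ, some monomial outside the
  initial ideal of the circuit ideal lies in that of the toric ideal. Like every standard monomial
  it is covered by a standard pair (\<open>standard_pair_cover\<close>), which cannot be a standard pair of the
  larger ideal: it is a CSP.

  Finally, \<open>Q\<close> is bounded for every admissible pair \<open>(x\<^sup>u, \<sigma>)\<close> of the initial ideal of the
  circuit ideal. A nonzero recession direction gives a nonzero real kernel vector
  \<open>v\<close> with \<open>v_i \<le> 0\<close> off \<open>\<sigma>\<close> and \<open>\<omega> \<cdot> v \<ge> 0\<close>. As \<open>v\<close> is a nonnegative combination of circuits that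
  agree with it in sign, one such circuit \<open>c\<close> has \<open>\<omega> \<cdot> c \<ge> 0\<close>
  (\<open>conformal_circuit_halfspace\<close>). The monomial of its positive part lies in the initial
  ideal and is supported in \<open>\<sigma>\<close>, which contradicts admissibility. The passage from real to
  integral vectors with the same signs, used here and for the finiteness of fibers, is simultaneous
  Dirichlet approximation (\<open>integral_solution_same_signs\<close>).
\<close>

section \<open>Ideals and homogeneous parts\<close>

lemma module_times: "module ((*) :: 'r::comm_ring_1 \<Rightarrow> 'r \<Rightarrow> 'r)"
  by unfold_locales (auto simp: algebra_simps)

lemma ideal_gen_base: "f \<in> S \<Longrightarrow> f \<in> ideal_gen S"
  unfolding ideal_gen_def by (rule module.span_base[OF module_times])

lemma ideal_gen_zero: "0 \<in> ideal_gen S"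
  unfolding ideal_gen_def by (rule module.span_zero[OF module_times])

lemma ideal_gen_add: "f \<in> ideal_gen S \<Longrightarrow> g \<in> ideal_gen S \<Longrightarrow> f + g \<in> ideal_gen S"
  unfolding ideal_gen_def by (rule module.span_add[OF module_times])

lemma ideal_gen_diff: "f \<in> ideal_gen S \<Longrightarrow> g \<in> ideal_gen S \<Longrightarrow> f - g \<in> ideal_gen S"
  unfolding ideal_gen_def by (rule module.span_diff[OF module_times])

lemma ideal_gen_mult: "f \<in> ideal_gen S \<Longrightarrow> q * f \<in> ideal_gen S"
  unfolding ideal_gen_def by (rule module.span_scale[OF module_times])

lemma ideal_gen_mono: "S \<subseteq> T \<Longrightarrow> ideal_gen S \<subseteq> ideal_gen T"
  unfolding ideal_gen_def by (rule module.span_mono[OF module_times])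

lemma ideal_gen_minimal: "S \<subseteq> ideal_gen T \<Longrightarrow> ideal_gen S \<subseteq> ideal_gen T"
  unfolding ideal_gen_def
  by (rule module.span_minimal[OF module_times _ module.subspace_span[OF module_times]])

lemma poly_mapping_term_induct [case_names zero monom add]:
  fixes f :: "'a \<Rightarrow>\<^sub>0 'b::comm_monoid_add"
  assumes "P 0" and "\<And>a c. P (Poly_Mapping.single a c)"
    and add: "\<And>f g. P f \<Longrightarrow> P g \<Longrightarrow> P (f + g)"
  shows "P f"
proof (induction f rule: update_induct)
  case const
  show ?case by fact
next
  case (update f a b)
  then have "Poly_Mapping.update a b f = f + Poly_Mapping.single a b"
    by (intro poly_mapping_eqI)
      (auto simp: lookup_update lookup_add lookup_single when_def in_keys_iff)
  with update add assms(2) show ?case by metis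
qed

text \<open>
  Elements of an ideal are sums of terms times generators, and single terms interact well with
  degrees and weights, while arbitrary multipliers do not.
\<close>

lemma ideal_gen_term_induct [consumes 1, case_names zero add step]:
  fixes f :: "('a::comm_monoid_add) \<Rightarrow>\<^sub>0 ('b::comm_ring_1)"
  assumes "f \<in> ideal_gen S" and zero: "P 0"
    and add: "\<And>f g. P f \<Longrightarrow> P g \<Longrightarrow> P (f + g)"
    and step: "\<And>a c g. g \<in> S \<Longrightarrow> P (Poly_Mapping.single a c * g)"
  shows "P f"
proof -
  have mult: "P (q * g)" if "g \<in> S" for q g
    by (induction q rule: poly_mapping_term_induct)
      (auto simp: distrib_right zero intro: add step that)
  show ?thesis
    using assms(1) unfolding ideal_gen_def
    by (rule module.span_induct_alt[OF module_times]) (auto intro: zero add mult)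
qed

definition part :: "('a \<Rightarrow> bool) \<Rightarrow> ('a \<Rightarrow>\<^sub>0 'b::zero) \<Rightarrow> 'a \<Rightarrow>\<^sub>0 'b" where
  "part P f = Poly_Mapping.mapp (\<lambda>k c. if P k then c else 0) f"

lemma lookup_part: "Poly_Mapping.lookup (part P f) k = (if P k then Poly_Mapping.lookup f k else 0)"
  by (auto simp: part_def lookup_mapp when_def in_keys_iff)

lemma keys_part: "Poly_Mapping.keys (part P f) = {k \<in> Poly_Mapping.keys f. P k}"
  by (auto simp: in_keys_iff lookup_part split: if_splits)

lemma part_zero [simp]: "part P 0 = 0"
  by (intro poly_mapping_eqI) (simp add: lookup_part)

lemma part_add: "part P (f + g) = part P f + part P g"
  for f :: "'a \<Rightarrow>\<^sub>0 'b::monoid_add"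
  by (intro poly_mapping_eqI) (simp add: lookup_part lookup_add)

lemma part_part: "part P (part Q f) = part (\<lambda>k. P k \<and> Q k) f"
  by (intro poly_mapping_eqI) (simp add: lookup_part)

lemma part_cong:
  "(\<And>k. k \<in> Poly_Mapping.keys f \<Longrightarrow> P k \<longleftrightarrow> Q k) \<Longrightarrow> part P f = part Q f"
  by (intro poly_mapping_eqI) (auto simp: lookup_part in_keys_iff)

lemma part_all: "(\<And>k. k \<in> Poly_Mapping.keys f \<Longrightarrow> P k) \<Longrightarrow> part P f = f"
  by (intro poly_mapping_eqI) (auto simp: lookup_part in_keys_iff)

lemma part_none: "(\<And>k. k \<in> Poly_Mapping.keys f \<Longrightarrow> \<not> P k) \<Longrightarrow> part P f = 0"
  by (intro poly_mapping_eqI) (auto simp: lookup_part in_keys_iff)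

lemma part_term: "part P (Poly_Mapping.single t c) = (if P t then Poly_Mapping.single t c else 0)"
  by (intro poly_mapping_eqI) (auto simp: lookup_part lookup_single when_def)

lemma part_term_mult:
  fixes f :: "('a::comm_monoid_add) \<Rightarrow>\<^sub>0 ('b::comm_ring_1)"
  shows "part P (Poly_Mapping.single a c * f) =
    Poly_Mapping.single a c * part (\<lambda>s. P (a + s)) f"
  by (induction f rule: poly_mapping_term_induct)
    (auto simp: part_add distrib_left mult_single part_term)

definition graded :: "('a \<Rightarrow> 'e) \<Rightarrow> ('a \<Rightarrow>\<^sub>0 'b::zero) set \<Rightarrow> bool" where
  "graded deg I \<longleftrightarrow> (\<forall>f\<in>I. \<forall>b. part (\<lambda>s. deg s = b) f \<in> I)"

lemma graded_ideal_gen: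
  fixes S :: "(('a::comm_monoid_add) \<Rightarrow>\<^sub>0 ('b::comm_ring_1)) set"
  assumes deg: "\<And>a s. deg (a + s) = deg a + deg s"
    and hom: "\<And>g. g \<in> S \<Longrightarrow> \<exists>b. \<forall>s\<in>Poly_Mapping.keys g. deg s = b"
  shows "graded deg (ideal_gen S)"
  unfolding graded_def
proof (intro ballI allI)
  fix f b assume "f \<in> ideal_gen S"
  then show "part (\<lambda>s. deg s = b) f \<in> ideal_gen S"
  proof (induction rule: ideal_gen_term_induct)
    case (step a c g)
    from hom[OF step] obtain b' where b': "\<forall>s\<in>Poly_Mapping.keys g. deg s = b'" by blast
    have "part (\<lambda>s. deg (a + s) = b) g \<in> {g, 0}"
      using b' by (cases "deg a + b' = b") (auto simp: deg intro: part_all part_none)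
    then show ?case
      using ideal_gen_mult[OF ideal_gen_base[OF step]]
      by (auto simp: part_term_mult ideal_gen_zero)
  qed (auto simp: part_add intro: ideal_gen_zero ideal_gen_add)
qed

section \<open>Initial ideals\<close>

lemma weight_add: "weight w (u + v) = weight w u + weight w v"
  by (simp add: weight_def distrib_left sum.distrib)

lemma initial_form_eq_part:
  "initial_form w f = part (\<lambda>u. \<forall>v\<in>Poly_Mapping.keys f. weight w v \<le> weight w u) f"
proof (intro poly_mapping_eqI)
  fix k
  let ?S = "{u \<in> Poly_Mapping.keys f. \<forall>v \<in> Poly_Mapping.keys f. weight w v \<le> weight w u}"
  have "Poly_Mapping.lookup (initial_form w f) k =
      (\<Sum>u\<in>?S. if u = k then Poly_Mapping.lookup f k else 0)"
    unfolding initial_form_def lookup_sum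
    by (intro sum.cong) (auto simp: lookup_single when_def)
  also have "\<dots> = (if k \<in> ?S then Poly_Mapping.lookup f k else 0)"
    by (subst sum.delta) auto
  also have "\<dots> = Poly_Mapping.lookup
      (part (\<lambda>u. \<forall>v\<in>Poly_Mapping.keys f. weight w v \<le> weight w u) f) k"
    by (auto simp: lookup_part in_keys_iff)
  finally show "Poly_Mapping.lookup (initial_form w f) k = \<dots>" .
qed

lemma initial_form_zero [simp]: "initial_form w 0 = 0"
  by (simp add: initial_form_eq_part)

lemma initial_form_top_weight:
  assumes "f \<noteq> 0"
  obtains d where "\<And>s. s \<in> Poly_Mapping.keys f \<Longrightarrow> weight w s \<le> d"
    and "\<exists>s\<in>Poly_Mapping.keys f. weight w s = d"
    and "initial_form w f = part (\<lambda>s. weight w s = d) f"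
proof -
  have ne: "weight w ` Poly_Mapping.keys f \<noteq> {}"
    using assms by simp
  define d where "d = Max (weight w ` Poly_Mapping.keys f)"
  have le: "weight w s \<le> d" if "s \<in> Poly_Mapping.keys f" for s
    using that by (simp add: d_def)
  have ex: "\<exists>s\<in>Poly_Mapping.keys f. weight w s = d"
    using Max_in[OF _ ne] by (auto simp: d_def)
  have "(\<forall>v\<in>Poly_Mapping.keys f. weight w v \<le> weight w k) \<longleftrightarrow> weight w k = d"
    if "k \<in> Poly_Mapping.keys f" for k
    using le[OF that] le ex by (metis order_antisym)
  then have "initial_form w f = part (\<lambda>s. weight w s = d) f"
    unfolding initial_form_eq_part by (intro part_cong)
  with le ex show ?thesis by (rule that)
qed

lemma initial_form_in_initial_ideal: "f \<in> I \<Longrightarrow> initial_form w f \<in> initial_ideal w I"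
  unfolding initial_ideal_def by (intro ideal_gen_base imageI)

text \<open>
  The initial forms of a graded ideal already make up all bihomogeneous elements of its initial
  ideal. In a sum of terms times initial forms, the summands of weight \<open>d\<close> are initial forms of
  terms times elements of \<open>I\<close>; the other summands do not contribute to weight \<open>d\<close> and can be
  dropped, and gradedness cuts the lifted sum down to degree \<open>b\<close>.
\<close>

lemma initial_ideal_lift:
  fixes S :: "('n::finite, 'k::field) mpoly set"
  assumes graded: "graded deg (ideal_gen S)" and h: "h \<in> initial_ideal w (ideal_gen S)"
  shows "\<exists>g \<in> ideal_gen S. (\<forall>s\<in>Poly_Mapping.keys g. deg s = b \<and> weight w s \<le> d) \<and>
    part (\<lambda>s. weight w s = d) g = part (\<lambda>s. deg s = b \<and> weight w s = d) h"
  using h unfolding initial_ideal_def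
proof (induction rule: ideal_gen_term_induct)
  case zero
  show ?case by (rule bexI[of _ 0]) (auto simp: ideal_gen_zero)
next
  case (add f f')
  from add obtain g g' where "g \<in> ideal_gen S" "g' \<in> ideal_gen S"
    "\<forall>s\<in>Poly_Mapping.keys g. deg s = b \<and> weight w s \<le> d"
    "\<forall>s\<in>Poly_Mapping.keys g'. deg s = b \<and> weight w s \<le> d"
    "part (\<lambda>s. weight w s = d) g = part (\<lambda>s. deg s = b \<and> weight w s = d) f"
    "part (\<lambda>s. weight w s = d) g' = part (\<lambda>s. deg s = b \<and> weight w s = d) f'"
    by blast
  then show ?case
    using Poly_Mapping.keys_add[of g g']
    by (intro bexI[of _ "g + g'"]) (auto simp: part_add ideal_gen_add)
next
  case (step a c h')
  then obtain f where f: "f \<in> ideal_gen S" "h' = initial_form w f" by auto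
  show ?case
  proof (cases "f = 0")
    case True
    then show ?thesis using f by (intro bexI[of _ 0]) (auto simp: ideal_gen_zero)
  next
    case False
    then obtain e where e: "\<And>s. s \<in> Poly_Mapping.keys f \<Longrightarrow> weight w s \<le> e"
      and ini: "initial_form w f = part (\<lambda>s. weight w s = e) f"
      by (rule initial_form_top_weight) blast
    let ?t = "Poly_Mapping.single a c"
    show ?thesis
    proof (cases "weight w a + e = d")
      case neq: False
      have "part (\<lambda>s. deg (a + s) = b \<and> weight w (a + s) = d \<and> weight w s = e) f = 0"
        using neq by (intro part_none) (auto simp: weight_add)
      then have "part (\<lambda>s. deg s = b \<and> weight w s = d) (?t * h') = 0"
        by (simp add: f ini part_term_mult part_part)
      then show ?thesis by (intro bexI[of _ 0]) (auto simp: ideal_gen_zero)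
    next
      case eq: True
      let ?g = "part (\<lambda>s. deg s = b) (?t * f)"
      have "?g \<in> ideal_gen S"
        using graded f by (auto simp: graded_def intro: ideal_gen_mult)
      moreover have "weight w s \<le> d" if s: "s \<in> Poly_Mapping.keys (?t * f)" for s
      proof -
        from s Poly_Mapping.keys_mult[of ?t f] obtain r where "s = a + r" "r \<in> Poly_Mapping.keys f"
          by (auto split: if_splits)
        then show ?thesis using e[of r] eq by (simp add: weight_add)
      qed
      moreover have "part (\<lambda>s. weight w s = d) ?g = part (\<lambda>s. deg s = b \<and> weight w s = d) (?t * h')"
      proof -
        have "part (\<lambda>s. weight w (a + s) = d \<and> deg (a + s) = b) f =
            part (\<lambda>s. deg (a + s) = b \<and> weight w (a + s) = d \<and> weight w s = e) f"
          using eq by (intro part_cong) (auto simp: weight_add)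
        then show ?thesis by (simp add: f ini part_term_mult part_part)
      qed
      ultimately show ?thesis by (intro bexI[of _ ?g]) (auto simp: keys_part)
    qed
  qed
qed

text \<open>
  This is the reduction of \<open>f\<close> modulo \<open>I\<close>: the initial form of \<open>f\<close> is also that of some
  \<open>g \<in> I\<close> of the same degree, so \<open>f - g\<close> has smaller top weight. For every real
  weight the process stops, because it stays inside one finite fiber of \<open>deg\<close>.
\<close>

lemma homogeneous_in_ideal_if_initial_ideal_le:
  fixes S T :: "('n::finite, 'k::field) mpoly set"
  assumes graded: "graded deg (ideal_gen S)" and fin: "finite {s. deg s = b}"
    and sub: "ideal_gen S \<subseteq> ideal_gen T"
    and ini: "initial_ideal w (ideal_gen T) \<subseteq> initial_ideal w (ideal_gen S)"
    and f: "f \<in> ideal_gen T" "\<forall>s\<in>Poly_Mapping.keys f. deg s = b"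
  shows "f \<in> ideal_gen S"
  using f
proof (induction "card {s. deg s = b \<and> (\<exists>t\<in>Poly_Mapping.keys f. weight w s \<le> weight w t)}"
    arbitrary: f rule: less_induct)
  case less
  show ?case
  proof (cases "f = 0")
    case True
    then show ?thesis by (simp add: ideal_gen_zero)
  next
    case False
    then obtain d where d: "\<And>s. s \<in> Poly_Mapping.keys f \<Longrightarrow> weight w s \<le> d"
      and ex: "\<exists>s\<in>Poly_Mapping.keys f. weight w s = d"
      and f_ini: "initial_form w f = part (\<lambda>s. weight w s = d) f"
      by (rule initial_form_top_weight) blast
    have "initial_form w f \<in> initial_ideal w (ideal_gen S)"
      using initial_form_in_initial_ideal[OF less.prems(1)] ini by blast
    from initial_ideal_lift[OF graded this, of b d] obtain g where g: "g \<in> ideal_gen S"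
      "\<forall>s\<in>Poly_Mapping.keys g. deg s = b \<and> weight w s \<le> d"
      "part (\<lambda>s. weight w s = d) g = part (\<lambda>s. deg s = b \<and> weight w s = d) (initial_form w f)"
      by blast
    have "part (\<lambda>s. deg s = b \<and> weight w s = d) (initial_form w f) = part (\<lambda>s. weight w s = d) f"
      unfolding f_ini part_part by (rule part_cong) (use less.prems in auto)
    with g have top: "part (\<lambda>s. weight w s = d) g = part (\<lambda>s. weight w s = d) f" by simp
    have below: "deg s = b \<and> weight w s < d" if "s \<in> Poly_Mapping.keys (f - g)" for s
    proof -
      have s: "s \<in> Poly_Mapping.keys f \<union> Poly_Mapping.keys g"
        using that by (auto simp: in_keys_iff lookup_minus)
      have "weight w s \<noteq> d"
        using arg_cong[OF top, of "\<lambda>p. Poly_Mapping.lookup p s"] that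
        by (simp add: lookup_part in_keys_iff lookup_minus split: if_splits)
      moreover have "deg s = b" "weight w s \<le> d"
        using s d[of s] g(2) less.prems(2) by auto
      ultimately show ?thesis by simp
    qed
    obtain t where t: "t \<in> Poly_Mapping.keys f" "weight w t = d" using ex by blast
    have "f - g \<in> ideal_gen S"
    proof (rule less.hyps)
      let ?A = "\<lambda>f. {s. deg s = b \<and> (\<exists>t\<in>Poly_Mapping.keys f. weight w s \<le> weight w t)}"
      have "?A (f - g) \<subseteq> ?A f"
        using below t by (auto intro!: bexI[of _ t]) (meson less_le order_trans)
      moreover have "t \<in> ?A f"
        using t less.prems(2) by auto
      moreover have "t \<notin> ?A (f - g)"
        using t(2) below by fastforce
      ultimately have "?A (f - g) \<subset> ?A f" by blast
      moreover have "finite (?A f)" by (rule finite_subset[OF _ fin]) auto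
      ultimately show "card (?A (f - g)) < card (?A f)" by (rule psubset_card_mono[rotated])
      show "f - g \<in> ideal_gen T" using less.prems g sub by (auto intro: ideal_gen_diff)
      show "\<forall>s\<in>Poly_Mapping.keys (f - g). deg s = b" using below by blast
    qed
    from ideal_gen_add[OF this g(1)] show ?thesis by simp
  qed
qed

section \<open>Monomial ideals and standard pairs\<close>

lemma xmonom_mult: "xmonom u * xmonom v = xmonom (u + v)"
  by (simp add: xmonom_def mult_single)

lemma term_eq_mult_xmonom:
  fixes c :: "'k::field"
  shows "Poly_Mapping.single u c = Poly_Mapping.single 0 c * xmonom u"
  by (simp add: xmonom_def mult_single)

lemma monomial_ideal_keys:
  fixes M :: "('n::finite, 'k::field) mpoly set"
  assumes "monomial_ideal M" and f: "f \<in> M" and s: "s \<in> Poly_Mapping.keys f"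
  shows "xmonom s \<in> M"
proof -
  obtain U where U: "M = ideal_gen (xmonom ` U)"
    using assms(1) by (auto simp: monomial_ideal_def)
  have "\<forall>s\<in>Poly_Mapping.keys f. xmonom s \<in> M"
    using f unfolding U
  proof (induction rule: ideal_gen_term_induct)
    case (add f g)
    then show ?case using Poly_Mapping.keys_add[of f g] by blast
  next
    case (step a c g)
    then obtain u where u: "u \<in> U" "g = xmonom u" by blast
    have "Poly_Mapping.keys (Poly_Mapping.single a c * g) \<subseteq> {a + u}"
      by (simp add: u xmonom_def mult_single)
    moreover have "xmonom (a + u) \<in> ideal_gen (xmonom ` U)"
      unfolding xmonom_mult[symmetric] using u by (intro ideal_gen_mult ideal_gen_base imageI)
    ultimately show ?case by blast
  qed simp
  with s show ?thesis by blast
qed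

lemma monomial_ideal_le:
  fixes M :: "('n::finite, 'k::field) mpoly set"
  assumes "monomial_ideal M" and "\<And>s. xmonom s \<in> M \<Longrightarrow> xmonom s \<in> ideal_gen S"
  shows "M \<subseteq> ideal_gen S"
proof -
  obtain U where U: "M = ideal_gen (xmonom ` U)"
    using assms(1) by (auto simp: monomial_ideal_def)
  show ?thesis
    using assms(2) unfolding U by (intro ideal_gen_minimal) (auto intro: ideal_gen_base)
qed

text \<open>
  A pair covers \<open>s\<close> if \<open>s\<close> is \<open>u\<close> plus an exponent supported in \<open>\<sigma>\<close>. The admissible pair
  \<open>(s, {})\<close> covers \<open>s\<close>. Among all admissible pairs that do, one with the
  largest possible \<open>\<sigma>\<close> is standard: any pair that dominates it also covers \<open>s\<close>, so has the same
  \<open>\<sigma>\<close>, and then the same exponent because exponents vanish on \<open>\<sigma>\<close>.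
\<close>

lemma standard_pair_cover:
  fixes M :: "('n::finite, 'k::field) mpoly set"
  assumes s: "xmonom s \<notin> M"
  obtains u \<sigma> v where "standard_pair M u \<sigma>" "s = u + v" "supp v \<subseteq> \<sigma>"
proof -
  define cov where "cov = (\<lambda>(u, \<sigma>). admissible_pair M u \<sigma> \<and> u \<le> s \<and> supp (s - u) \<subseteq> \<sigma>)"
  have "cov (s, {})"
  proof -
    have "supp v = {} \<longleftrightarrow> v = 0" for v :: "nat^'n"
      by (simp add: supp_def vec_eq_iff)
    then show ?thesis
      using s by (simp add: cov_def admissible_pair_def xmonom_mult)
  qed
  moreover have "card (snd p) \<le> CARD('n)" for p :: "(nat^'n) \<times> 'n set"
    by (rule card_mono) auto
  ultimately obtain p where p: "cov p" "\<And>q. cov q \<Longrightarrow> card (snd q) \<le> card (snd p)"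
    using ex_has_greatest_nat[of cov "(s, {})" "\<lambda>p. card (snd p)" "CARD('n) + 1"]
    by (auto simp: less_Suc_eq_le)
  obtain u \<sigma> where uv: "p = (u, \<sigma>)" by (cases p)
  have adm: "admissible_pair M u \<sigma>" "u \<le> s" "supp (s - u) \<subseteq> \<sigma>"
    using p(1) by (auto simp: cov_def uv)
  have "standard_pair M u \<sigma>"
    unfolding standard_pair_def
  proof (intro conjI notI)
    show "admissible_pair M u \<sigma>" by fact
    assume "\<exists>v \<tau>. (v, \<tau>) \<noteq> (u, \<sigma>) \<and> admissible_pair M v \<tau> \<and> v \<le> u \<and> supp (u - v) \<union> \<sigma> \<subseteq> \<tau>"
    then obtain v \<tau> where v: "(v, \<tau>) \<noteq> (u, \<sigma>)" "admissible_pair M v \<tau>" "v \<le> u"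
      "supp (u - v) \<subseteq> \<tau>" "\<sigma> \<subseteq> \<tau>" by blast
    have "supp (s - v) \<subseteq> supp (s - u) \<union> supp (u - v)"
      using adm(2) v(3) by (auto simp: supp_def less_eq_vec_def)
    then have "cov (v, \<tau>)"
      using v adm by (auto simp: cov_def intro: order_trans)
    from p(2)[OF this] have "\<tau> = \<sigma>"
      using v(5) card_seteq[of \<tau> \<sigma>] by (simp add: uv)
    moreover have "u = v"
    proof -
      have "u $ i = v $ i" for i
      proof (cases "i \<in> \<sigma>")
        case True
        then have "u $ i = 0" using adm(1) by (auto simp: admissible_pair_def supp_def)
        moreover have "v $ i \<le> u $ i" using v(3) by (simp add: less_eq_vec_def)
        ultimately show ?thesis by simp
      next
        case False
        then have "u $ i - v $ i = 0" using v(4) \<open>\<tau> = \<sigma>\<close> by (auto simp: supp_def)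
        moreover have "v $ i \<le> u $ i" using v(3) by (simp add: less_eq_vec_def)
        ultimately show ?thesis by simp
      qed
      then show ?thesis by (simp add: vec_eq_iff)
    qed
    ultimately show False using v(1) by simp
  qed
  moreover have "s = u + (s - u)"
    using adm(2) by (simp add: less_eq_vec_def vec_eq_iff)
  ultimately show ?thesis using adm(3) by (rule that)
qed

text \<open>Standard pairs of \<open>M\<close> cover the monomials outside \<open>M\<close>, so they detect a larger ideal.\<close>

lemma standard_pair_separates:
  fixes M :: "('n::finite, 'k::field) mpoly set"
  assumes "xmonom s \<notin> M" and "xmonom s \<in> N"
  obtains u \<sigma> where "standard_pair M u \<sigma>" "\<not> standard_pair N u \<sigma>"
proof -
  obtain u \<sigma> v where *: "standard_pair M u \<sigma>" "s = u + v" "supp v \<subseteq> \<sigma>"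
    using assms(1) by (rule standard_pair_cover)
  have "\<not> standard_pair N u \<sigma>"
    using assms(2) * by (auto simp: standard_pair_def admissible_pair_def xmonom_mult)
  with * show ?thesis by (intro that)
qed

section \<open>Integral and real solutions of integral linear systems\<close>

text \<open>
  Simultaneous Dirichlet approximation gives a positive integer multiple \<open>q v\<close> within \<open>1/N\<close> of an
  integral vector \<open>p\<close>. For large \<open>N\<close> rounding does not change signs because \<open>q \<ge> 1\<close>, and
  the left-hand sides at \<open>p\<close> are integers of absolute value below \<open>1\<close>.
\<close>

lemma integral_solution_same_signs:
  fixes a :: "'r \<Rightarrow> 'i \<Rightarrow> int" and v :: "'i \<Rightarrow> real"
  assumes fin: "finite I" "finite R"
    and sol: "\<And>r. r \<in> R \<Longrightarrow> (\<Sum>i\<in>I. of_int (a r i) * v i) = 0"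
  obtains p :: "'i \<Rightarrow> int"
  where "\<And>i. i \<in> I \<Longrightarrow> of_int (sgn (p i)) = sgn (v i)"
    and "\<And>r. r \<in> R \<Longrightarrow> (\<Sum>i\<in>I. a r i * p i) = 0"
proof -
  \<comment> \<open>Every \<open>N\<close> above \<open>C\<close> is fine enough: the two sums serve the signs and the equations.\<close>
  define C where "C = (\<Sum>i\<in>I. 1 / \<bar>v i\<bar>) + (\<Sum>r\<in>R. \<Sum>i\<in>I. \<bar>of_int (a r i)\<bar>) + (1::real)"
  have C_v: "1 / \<bar>v i\<bar> < C" if "i \<in> I" for i
  proof -
    have "1 / \<bar>v i\<bar> \<le> (\<Sum>i\<in>I. 1 / \<bar>v i\<bar>)"
      using that fin by (intro member_le_sum) auto
    moreover have "0 \<le> (\<Sum>r\<in>R. \<Sum>i\<in>I. \<bar>of_int (a r i)\<bar> :: real)"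
      by (intro sum_nonneg) auto
    ultimately show ?thesis by (simp add: C_def)
  qed
  have C_a: "(\<Sum>i\<in>I. \<bar>of_int (a r i)\<bar>) < C" if "r \<in> R" for r
  proof -
    have "(\<Sum>i\<in>I. \<bar>of_int (a r i)\<bar>) \<le> (\<Sum>r\<in>R. \<Sum>i\<in>I. \<bar>of_int (a r i)\<bar> :: real)"
      using that fin by (intro member_le_sum) (auto intro: sum_nonneg)
    moreover have "0 \<le> (\<Sum>i\<in>I. 1 / \<bar>v i\<bar>)"
      by (intro sum_nonneg) auto
    ultimately show ?thesis by (simp add: C_def)
  qed
  have "0 < C"
    unfolding C_def by (intro add_nonneg_pos add_nonneg_nonneg sum_nonneg) auto
  then obtain N :: nat where N: "C < real N" "0 < N"
    using reals_Archimedean2[of C] by (metis less_trans of_nat_0_less_iff)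
  obtain e :: "'i \<Rightarrow> nat" where e: "bij_betw e I {0..<card I}"
    using ex_bij_betw_finite_nat[OF fin(1)] by blast
  let ?v = "\<lambda>k. v (inv_into I e k)"
  obtain q p0 where q: "0 < q"
    and p0: "\<And>k. k < card I \<Longrightarrow> \<bar>of_int q * ?v k - of_int (p0 k)\<bar> < 1 / real N"
    by (rule Dirichlet_approx_simult[OF \<open>0 < N\<close>, where \<theta> = ?v and n = "card I"]) blast
  define p where "p i = p0 (e i)" for i
  have close: "\<bar>of_int q * v i - of_int (p i)\<bar> < 1 / real N" if "i \<in> I" for i
  proof -
    have "e i < card I" "inv_into I e (e i) = i"
      using e that bij_betwE[OF e] by (auto simp: bij_betw_def)
    then show ?thesis using p0[of "e i"] by (simp add: p_def)
  qed
  have N1: "1 / real N \<le> 1" using N by simp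
  have "of_int (sgn (p i)) = sgn (v i)" if i: "i \<in> I" for i
  proof (cases "v i = 0")
    case True
    have "\<bar>real_of_int (p i)\<bar> < 1" using close[OF i] N1 True by simp
    then have "p i = 0" by linarith
    then show ?thesis using True by simp
  next
    case False
    have "1 / \<bar>v i\<bar> < real N" using C_v[OF i] N by simp
    then have "1 / real N < \<bar>v i\<bar>" using False N by (simp add: field_simps)
    moreover have "\<bar>v i\<bar> \<le> real_of_int q * \<bar>v i\<bar>" using q by (simp add: mult_le_cancel_right1)
    moreover have "real_of_int q * \<bar>v i\<bar> = \<bar>real_of_int q * v i\<bar>" using q by (simp add: abs_mult)
    ultimately have *: "\<bar>real_of_int q * v i - of_int (p i)\<bar> < \<bar>real_of_int q * v i\<bar>"
      using close[OF i] by linarith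
    have "0 < v i \<Longrightarrow> 0 < real_of_int q * v i" "v i < 0 \<Longrightarrow> real_of_int q * v i < 0"
      using q by (simp_all add: mult_pos_neg)
    with * False have "0 < v i \<and> 0 < p i \<or> v i < 0 \<and> p i < 0" by linarith
    then show ?thesis by auto
  qed
  moreover have "(\<Sum>i\<in>I. a r i * p i) = 0" if r: "r \<in> R" for r
  proof -
    have "real_of_int (\<Sum>i\<in>I. a r i * p i) =
        (\<Sum>i\<in>I. of_int (a r i) * of_int (p i)) - of_int q * (\<Sum>i\<in>I. of_int (a r i) * v i)"
      using sol[OF r] by simp
    also have "\<dots> = (\<Sum>i\<in>I. of_int (a r i) * (of_int (p i) - of_int q * v i))"
      by (simp add: sum_distrib_left sum_subtractf algebra_simps)
    finally have "\<bar>real_of_int (\<Sum>i\<in>I. a r i * p i)\<bar> =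
        \<bar>\<Sum>i\<in>I. of_int (a r i) * (of_int (p i) - of_int q * v i)\<bar>" by simp
    also have "\<dots> \<le> (\<Sum>i\<in>I. \<bar>of_int (a r i)\<bar> * (1 / real N))"
    proof (intro order_trans[OF sum_abs] sum_mono)
      fix i assume "i \<in> I"
      from close[OF this]
      show "\<bar>of_int (a r i) * (of_int (p i) - of_int q * v i)\<bar> \<le> \<bar>of_int (a r i)\<bar> * (1 / real N)"
        unfolding abs_mult by (intro mult_left_mono) linarith+
    qed
    also have "\<dots> = (\<Sum>i\<in>I. \<bar>of_int (a r i)\<bar>) / real N"
      by (simp add: sum_divide_distrib)
    also have "\<dots> < 1" using C_a[OF r] N by simp
    finally show ?thesis by linarith
  qed
  ultimately show ?thesis by (rule that)
qed

lemma sgn_real_of_int: "sgn (real_of_int k) = of_int (sgn k)"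
  by (simp add: sgn_if)

definition real_vec :: "int^'n \<Rightarrow> real^'n" where
  "real_vec u = (\<chi> i. real_of_int (u $ i))"

lemma real_vec_nth [simp]: "real_vec u $ i = real_of_int (u $ i)"
  by (simp add: real_vec_def)

lemma kernel_lattice_nth:
  "u \<in> kernel_lattice A \<longleftrightarrow> (\<forall>r. (\<Sum>i\<in>UNIV. A $ r $ i * u $ i) = 0)"
  by (simp add: kernel_lattice_def vec_eq_iff matrix_vector_mult_def)

lemma real_kernel_nth:
  "map_matrix real_of_int A *v x = 0 \<longleftrightarrow> (\<forall>r. (\<Sum>i\<in>UNIV. of_int (A $ r $ i) * x $ i) = 0)"
  by (simp add: vec_eq_iff matrix_vector_mult_def map_matrix_def)

lemma real_kernel_real_vec:
  "map_matrix real_of_int A *v real_vec u = 0 \<longleftrightarrow> u \<in> kernel_lattice A"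
  unfolding real_kernel_nth kernel_lattice_nth
  by (simp flip: of_int_mult of_int_sum)

lemma lattice_vector_same_signs:
  fixes A :: "int^'n^'d" and x :: "real^'n"
  assumes "map_matrix real_of_int A *v x = 0"
  obtains p where "p \<in> kernel_lattice A" "\<And>i. of_int (sgn (p $ i)) = sgn (x $ i)"
proof -
  obtain p :: "'n \<Rightarrow> int" where "\<And>i. i \<in> UNIV \<Longrightarrow> of_int (sgn (p i)) = sgn (x $ i)"
    and "\<And>r. r \<in> UNIV \<Longrightarrow> (\<Sum>i\<in>UNIV. A $ r $ i * p i) = 0"
    using assms integral_solution_same_signs[of UNIV UNIV "\<lambda>r i. A $ r $ i" "\<lambda>i. x $ i"]
    by (auto simp: real_kernel_nth)
  then show ?thesis
    by (intro that[of "\<chi> i. p i"]) (auto simp: kernel_lattice_nth)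
qed

section \<open>Conformal circuits\<close>

definition conformal :: "int^'n \<Rightarrow> real^'n \<Rightarrow> bool" where
  "conformal c x \<longleftrightarrow> (\<forall>i. c $ i \<noteq> 0 \<longrightarrow> of_int (sgn (c $ i)) = sgn (x $ i))"

lemma kernel_lattice_combination:
  "u \<in> kernel_lattice A \<Longrightarrow> v \<in> kernel_lattice A \<Longrightarrow> a *s u - b *s v \<in> kernel_lattice A"
  by (simp add: kernel_lattice_nth right_diff_distrib sum_subtractf mult.left_commute
      flip: sum_distrib_left)

text \<open>
  Moving from \<open>d\<close> in the direction \<open>-e\<close> until the first coordinate vanishes keeps all signs. Here
  the step is scaled by \<open>\<bar>e $ i0\<bar>\<close> to stay integral, and minimality of \<open>d $ i0 / e $ i0\<close> is
  stated without division.
\<close>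

lemma conformal_elimination:
  fixes d e :: "int^'n"
  assumes d: "d \<in> kernel_lattice A" and e: "e \<in> kernel_lattice A" "e \<noteq> 0"
    and sub: "supp e \<subset> supp d"
  obtains d' where "d' \<in> kernel_lattice A" "d' \<noteq> 0" "supp d' \<subset> supp d" "conformal d' (real_vec d)"
proof -
  have main: "\<exists>d'. d' \<in> kernel_lattice A \<and> d' \<noteq> 0 \<and> supp d' \<subset> supp d \<and> conformal d' (real_vec d)"
    if e: "e \<in> kernel_lattice A" and sub: "supp e \<subset> supp d"
    and pos: "0 < e $ k * d $ k" for e k
  proof -
    \<comment> \<open>The coordinates of \<open>d\<close> that move towards \<open>0\<close> in the direction \<open>-e\<close>.\<close>
    define K where "K = {i. 0 < e $ i * d $ i}"
    let ?r = "\<lambda>i. real_of_int (d $ i) / real_of_int (e $ i)"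
    have "finite K" "K \<noteq> {}" using pos by (auto simp: K_def)
    then obtain i0 where i0: "i0 \<in> K" "\<And>i. i \<in> K \<Longrightarrow> ?r i0 \<le> ?r i"
      using ex_min_if_finite[of "?r ` K"] by (metis (no_types, lifting) finite_imageI image_iff image_is_empty not_le)
    have cross: "\<bar>d $ i0\<bar> * \<bar>e $ i\<bar> \<le> \<bar>e $ i0\<bar> * \<bar>d $ i\<bar>" if i: "i \<in> K" for i
    proof -
      have r: "?r i = \<bar>real_of_int (d $ i)\<bar> / \<bar>real_of_int (e $ i)\<bar>" if "i \<in> K" for i
        using that by (auto simp: K_def zero_less_mult_iff)
      have ne: "e $ i \<noteq> 0" if "i \<in> K" for i using that by (auto simp: K_def)
      have "\<bar>real_of_int (d $ i0)\<bar> * \<bar>real_of_int (e $ i)\<bar> \<le> \<bar>real_of_int (e $ i0)\<bar> * \<bar>real_of_int (d $ i)\<bar>"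
        using i0(2)[OF i] r[OF i] r[OF i0(1)] ne[OF i] ne[OF i0(1)] by (simp add: field_simps)
      then show ?thesis by (simp flip: of_int_abs of_int_mult)
    qed
    define s where "s = sgn (e $ i0)"
    define d' where "d' = (s * e $ i0) *s d - (s * d $ i0) *s e"
    have i0_ne: "e $ i0 \<noteq> 0" "d $ i0 \<noteq> 0" using i0 by (auto simp: K_def)
    have s: "s * e $ i0 = \<bar>e $ i0\<bar>" "s * d $ i0 = \<bar>d $ i0\<bar>"
      using i0 by (auto simp: s_def K_def zero_less_mult_iff)
    have nth: "d' $ i = \<bar>e $ i0\<bar> * d $ i - \<bar>d $ i0\<bar> * e $ i" for i
      by (simp add: d'_def s)
    have "d' \<in> kernel_lattice A"
      unfolding d'_def using d e by (rule kernel_lattice_combination)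
    moreover have "d' \<noteq> 0"
    proof -
      obtain j where "d $ j \<noteq> 0" "e $ j = 0" using sub by (auto simp: supp_def)
      then have "d' $ j \<noteq> 0" using i0_ne by (simp add: nth)
      then show ?thesis by auto
    qed
    moreover have "supp d' \<subset> supp d"
    proof -
      have "d' $ i0 = 0" using i0 by (auto simp: nth K_def zero_less_mult_iff)
      moreover have "d' $ i = 0" if "d $ i = 0" for i
        using that sub by (auto simp: nth supp_def)
      ultimately show ?thesis using i0_ne by (auto simp: supp_def)
    qed
    moreover have "conformal d' (real_vec d)"
      unfolding conformal_def
    proof (intro allI impI)
      fix i assume ne: "d' $ i \<noteq> 0"
      have di: "d $ i \<noteq> 0" using ne sub by (auto simp: nth supp_def)
      have "sgn (d' $ i) = sgn (d $ i)"
      proof (cases "i \<in> K")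
        case True
        then have "0 < d $ i \<and> 0 < e $ i \<or> d $ i < 0 \<and> e $ i < 0"
          by (auto simp: K_def zero_less_mult_iff)
        then show ?thesis using cross[OF True] ne by (auto simp: nth)
      next
        case False
        then have "(0 < d $ i \<and> e $ i \<le> 0) \<or> (d $ i < 0 \<and> 0 \<le> e $ i)"
          using di by (auto simp: K_def zero_less_mult_iff not_less)
        then show ?thesis
        proof
          assume *: "0 < d $ i \<and> e $ i \<le> 0"
          then have "0 < \<bar>e $ i0\<bar> * d $ i" "\<bar>d $ i0\<bar> * e $ i \<le> 0"
            using i0_ne by (auto simp: mult_nonneg_nonpos)
          then have "0 < d' $ i" unfolding nth by linarith
          then show ?thesis using * by simp
        next
          assume *: "d $ i < 0 \<and> 0 \<le> e $ i"
          then have "\<bar>e $ i0\<bar> * d $ i < 0" "0 \<le> \<bar>d $ i0\<bar> * e $ i"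
            using i0_ne by (auto simp: mult_pos_neg)
          then have "d' $ i < 0" unfolding nth by linarith
          then show ?thesis using * by simp
        qed
      qed
      then show "of_int (sgn (d' $ i)) = sgn (real_vec d $ i)"
        by (simp add: sgn_real_of_int)
    qed
    ultimately show ?thesis by blast
  qed
  obtain k where k: "e $ k \<noteq> 0" using e by (auto simp: vec_eq_iff)
  then have "d $ k \<noteq> 0" using sub by (auto simp: supp_def)
  with k consider "0 < e $ k * d $ k" | "0 < (- e) $ k * d $ k"
    by (metis linorder_neqE_linordered_idom mult_eq_0_iff mult_minus_left neg_0_less_iff_less vector_uminus_component)
  then show ?thesis
  proof cases
    case 1
    then show ?thesis using main[OF e(1) sub] that by blast
  next
    case 2
    have "- e \<in> kernel_lattice A" "supp (- e) = supp e"
      using e(1) by (simp_all add: kernel_lattice_nth sum_negf supp_def)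
    then show ?thesis using main[OF _ _ 2] sub that by auto
  qed
qed

text \<open>
  Among the nonzero lattice vectors conformal to \<open>x\<close>, one of smallest support is a multiple of a
  circuit.
\<close>

lemma conformal_circuit:
  fixes A :: "int^'n^'d"
  assumes "p \<in> kernel_lattice A" "p \<noteq> 0" "conformal p x"
  obtains c where "circuit A c" "conformal c x"
proof -
  define P where "P d \<longleftrightarrow> d \<in> kernel_lattice A \<and> d \<noteq> 0 \<and> conformal d x" for d
  have "P p" using assms by (simp add: P_def)
  then obtain d where d: "P d" "\<And>e. P e \<Longrightarrow> card (supp d) \<le> card (supp e)"
    using ex_has_least_nat[of P p "\<lambda>d. card (supp d)"] by blast
  define g where "g = Gcd (range (\<lambda>i. d $ i))"
  have dvd: "g dvd d $ i" for i by (simp add: g_def)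
  have "g \<noteq> 0" using d(1) by (auto simp: g_def P_def vec_eq_iff)
  moreover have "0 \<le> g" unfolding g_def by (rule Gcd_int_greater_eq_0)
  ultimately have g: "0 < g" by simp
  define c where "c = (\<chi> i. d $ i div g)"
  have c: "d $ i = g * c $ i" for i using dvd by (simp add: c_def)
  have supp_c: "supp c = supp d" using g by (auto simp: supp_def c)
  have "circuit A c"
    unfolding circuit_def
  proof (intro conjI notI)
    show "c \<in> kernel_lattice A"
      using d(1) g by (simp add: P_def kernel_lattice_nth c mult.left_commute flip: sum_distrib_left)
    assume "c = 0"
    with d(1) show False by (simp add: P_def vec_eq_iff c)
  next
    have range: "range (\<lambda>i. d $ i) = (*) g ` range (\<lambda>i. c $ i)"
      by (simp add: c image_image)
    have "g = Gcd ((*) g ` range (\<lambda>i. c $ i))"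
      unfolding range[symmetric] by (rule g_def)
    also have "\<dots> = normalize g * Gcd (range (\<lambda>i. c $ i))"
      by (simp only: Gcd_mult normalize_mult normalize_Gcd)
    finally show "Gcd (range (\<lambda>i. c $ i)) = 1" using g by simp
  next
    assume "\<exists>e\<in>kernel_lattice A. e \<noteq> 0 \<and> supp e \<subset> supp c"
    then obtain e where "e \<in> kernel_lattice A" "e \<noteq> 0" "supp e \<subset> supp d"
      by (auto simp: supp_c)
    with d(1) obtain d' where d': "d' \<in> kernel_lattice A" "d' \<noteq> 0" "supp d' \<subset> supp d"
      "conformal d' (real_vec d)"
      by (metis P_def conformal_elimination)
    have "conformal d' x"
      unfolding conformal_def
    proof (intro allI impI)
      fix i assume i: "d' $ i \<noteq> 0"
      then have "d $ i \<noteq> 0" using d'(3) by (auto simp: supp_def)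
      then show "of_int (sgn (d' $ i)) = sgn (x $ i)"
        using i d'(4) d(1) by (simp add: P_def conformal_def sgn_real_of_int)
    qed
    with d' have "P d'" by (simp add: P_def)
    from d(2)[OF this] psubset_card_mono[OF _ d'(3)] show False by simp
  qed
  moreover have "conformal c x"
    using d(1) g by (auto simp: P_def conformal_def c sgn_mult)
  ultimately show ?thesis by (rule that)
qed

text \<open>
  Every real kernel vector is a nonnegative combination of conformal circuits; subtracting one
  circuit at a time, one of them has to lie on the same side of a linear functional as \<open>x\<close>.
\<close>

lemma conformal_circuit_halfspace:
  fixes A :: "int^'n^'d" and x w :: "real^'n"
  assumes "map_matrix real_of_int A *v x = 0" "x \<noteq> 0" "0 \<le> inner w x"
  obtains c where "circuit A c" "conformal c x" "0 \<le> inner w (real_vec c)"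
proof -
  have "\<exists>c. circuit A c \<and> conformal c x \<and> 0 \<le> inner w (real_vec c)"
    using assms
  proof (induction "card (supp x)" arbitrary: x rule: less_induct)
    case less
    obtain p where p: "p \<in> kernel_lattice A" "\<And>i. of_int (sgn (p $ i)) = sgn (x $ i)"
      using lattice_vector_same_signs[OF less.prems(1)] by blast
    have "p \<noteq> 0"
    proof
      assume "p = 0"
      with p(2) have "x $ i = 0" for i by (metis of_int_0 sgn_0 sgn_0_0 zero_index)
      with less.prems show False by (simp add: vec_eq_iff)
    qed
    moreover have "conformal p x" using p by (simp add: conformal_def)
    ultimately obtain c where c: "circuit A c" "conformal c x"
      using conformal_circuit p(1) by blast
    show ?case
    proof (cases "0 \<le> inner w (real_vec c)")
      case True
      with c show ?thesis by blast
    next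
      case neg: False
      let ?r = "\<lambda>i. x $ i / of_int (c $ i)"
      have "supp c \<noteq> {}" using c(1) by (auto simp: circuit_def supp_def vec_eq_iff)
      then have "finite (?r ` supp c)" "?r ` supp c \<noteq> {}" by auto
      then obtain i0 where i0: "i0 \<in> supp c" "\<And>i. i \<in> supp c \<Longrightarrow> ?r i0 \<le> ?r i"
        using Min_in[of "?r ` supp c"] Min_le[of "?r ` supp c"] by (metis (no_types, lifting) image_iff imageI)
      \<comment> \<open>\<open>t\<close> is the largest multiple of \<open>c\<close> that can be removed without changing a sign.\<close>
      define t where "t = ?r i0"
      define y where "y = x - t *\<^sub>R real_vec c"
      have same: "0 < c $ i \<and> 0 < x $ i \<or> c $ i < 0 \<and> x $ i < 0" if "c $ i \<noteq> 0" for i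
      proof -
        from that c(2) have "of_int (sgn (c $ i)) = sgn (x $ i)" by (simp add: conformal_def)
        then show ?thesis using that by (auto simp: sgn_if split: if_splits)
      qed
      have t: "0 < t"
        using same[of i0] i0(1) by (auto simp: t_def supp_def divide_neg_neg)
      have y_nth: "y $ i = x $ i - t * of_int (c $ i)" for i by (simp add: y_def)
      have y_sgn: "sgn (y $ i) = sgn (x $ i)" if "y $ i \<noteq> 0" for i
      proof (cases "c $ i = 0")
        case False
        have ti: "t \<le> ?r i" using i0(2)[of i] False by (simp add: t_def supp_def)
        from same[OF False] show ?thesis
        proof
          assume *: "0 < c $ i \<and> 0 < x $ i"
          then have "t * of_int (c $ i) \<le> x $ i" using ti by (simp add: field_simps)
          then show ?thesis using * that by (simp add: y_nth)
        next
          assume *: "c $ i < 0 \<and> x $ i < 0"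
          then have "x $ i \<le> t * of_int (c $ i)" using ti by (simp add: field_simps)
          then show ?thesis using * that by (simp add: y_nth)
        qed
      qed (simp add: y_nth)
      have "y $ i0 = 0" "x $ i0 \<noteq> 0"
        using i0(1) same[of i0] by (auto simp: y_nth t_def supp_def)
      moreover have "x $ i \<noteq> 0" if "y $ i \<noteq> 0" for i
        using y_sgn[OF that] that by (auto simp: sgn_zero_iff)
      ultimately have "supp y \<subset> supp x" by (auto simp: supp_def)
      then have "card (supp y) < card (supp x)" by (simp add: psubset_card_mono)
      moreover have "map_matrix real_of_int A *v real_vec c = 0"
        using c(1) by (simp add: circuit_def real_kernel_real_vec)
      then have "map_matrix real_of_int A *v y = 0"
        using less.prems(1) by (simp add: y_def matrix_vector_mult_diff_distrib
            matrix_vector_mult_scaleR)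
      moreover have wy: "0 < inner w y"
      proof -
        have "t * inner w (real_vec c) < 0" using neg t by (simp add: mult_pos_neg)
        then show ?thesis using less.prems(3) by (simp add: y_def inner_diff_right)
      qed
      moreover have "y \<noteq> 0" using wy by auto
      ultimately obtain c' where c': "circuit A c'" "conformal c' y" "0 \<le> inner w (real_vec c')"
        using less.hyps[of y] by auto
      have "conformal c' x"
        unfolding conformal_def
      proof (intro allI impI)
        fix i assume i: "c' $ i \<noteq> 0"
        with c'(2) have "of_int (sgn (c' $ i)) = sgn (y $ i)" by (simp add: conformal_def)
        moreover from this i have "y $ i \<noteq> 0" by (auto simp: sgn_if split: if_splits)
        ultimately show "of_int (sgn (c' $ i)) = sgn (x $ i)" using y_sgn by simp
      qed
      with c' show ?thesis by blast
    qed
  qed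
  with that show ?thesis by blast
qed

section \<open>Boundedness\<close>

text \<open>By homogeneity it is enough to bound \<open>f\<close> from below on the compact set of unit vectors.\<close>

lemma positive_on_cone_lower_bound:
  fixes f :: "'a::euclidean_space \<Rightarrow> real"
  assumes S: "closed S" "\<And>x t. x \<in> S \<Longrightarrow> 0 \<le> t \<Longrightarrow> t *\<^sub>R x \<in> S"
    and f: "continuous_on UNIV f" "\<And>x t. 0 \<le> t \<Longrightarrow> f (t *\<^sub>R x) = t * f x"
    and pos: "\<And>x. x \<in> S \<Longrightarrow> x \<noteq> 0 \<Longrightarrow> 0 < f x"
  obtains e where "0 < e" "\<And>x. x \<in> S \<Longrightarrow> e * norm x \<le> f x"
proof -
  let ?K = "S \<inter> sphere 0 1"
  have f0: "f 0 = 0" using f(2)[of 0 0] by simp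
  have unit: "(1 / norm x) *\<^sub>R x \<in> ?K" if "x \<in> S" "x \<noteq> 0" for x
    using that S(2)[of x "1 / norm x"] by simp
  show ?thesis
  proof (cases "?K = {}")
    case True
    then have "x = 0" if "x \<in> S" for x using unit that by blast
    then have "1 * norm x \<le> f x" if "x \<in> S" for x using f0 that by fastforce
    then show ?thesis by (intro that[of 1]) auto
  next
    case False
    have "compact ?K" using S(1) by (intro closed_Int_compact) auto
    moreover have "continuous_on ?K f" using f(1) by (rule continuous_on_subset) auto
    ultimately obtain y where y: "y \<in> ?K" "\<And>x. x \<in> ?K \<Longrightarrow> f y \<le> f x"
      using False continuous_attains_inf[of ?K f] by blast
    have "f y * norm x \<le> f x" if x: "x \<in> S" for x
    proof (cases "x = 0")
      case True
      then show ?thesis by (simp add: f0)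
    next
      case False
      then have "f y \<le> (1 / norm x) * f x"
        using y(2)[OF unit[OF x]] f(2)[of "1 / norm x" x] by simp
      then show ?thesis using False by (simp add: field_simps)
    qed
    moreover have "0 < f y" using y(1) by (intro pos) auto
    ultimately show ?thesis by (intro that)
  qed
qed

text \<open>
  This is the multidegree of \<open>x\<^sup>s\<close> when \<open>x_i\<close> has degree \<open>a_i\<close>; the two terms of a lattice
  binomial have the same one.
\<close>

definition exp_degree :: "int^'n^'d \<Rightarrow> nat^'n \<Rightarrow> int^'d" where
  "exp_degree A s = A *v (\<chi> i. int (s $ i))"

lemma exp_degree_add: "exp_degree A (s + t) = exp_degree A s + exp_degree A t"
  by (simp add: exp_degree_def vec_eq_iff matrix_vector_mult_def distrib_left sum.distrib)

lemma exp_degree_pos_neg: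
  assumes "u \<in> kernel_lattice A"
  shows "exp_degree A (pos_part u) = exp_degree A (neg_part u)"
proof -
  have "A *v (\<chi> i. int (pos_part u $ i)) - A *v (\<chi> i. int (neg_part u $ i)) =
      A *v ((\<chi> i. int (pos_part u $ i)) - (\<chi> i. int (neg_part u $ i)))"
    by (simp add: vec_eq_iff matrix_vector_mult_def right_diff_distrib sum_subtractf)
  also have "(\<chi> i. int (pos_part u $ i)) - (\<chi> i. int (neg_part u $ i)) = u"
    by (auto simp: vec_eq_iff pos_part_def neg_part_def)
  finally show ?thesis using assms by (simp add: exp_degree_def kernel_lattice_def)
qed

text \<open>
  Rounding shows that the real kernel meets the nonnegative orthant only in \<open>0\<close>, because the
  lattice does; so the norm of \<open>A s\<close> bounds the norm of a nonnegative \<open>s\<close>.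
\<close>

lemma finite_fiber:
  fixes A :: "int^'n^'d"
  assumes "kernel_lattice A \<inter> {u. \<forall>i. 0 \<le> u $ i} = {0}"
  shows "finite {s. exp_degree A s = b}"
proof -
  let ?M = "map_matrix real_of_int A"
  let ?S = "{x :: real^'n. \<forall>i. 0 \<le> x $ i}"
  have pos: "0 < norm (?M *v x)" if x: "x \<in> ?S" "x \<noteq> 0" for x
  proof (rule ccontr)
    assume "\<not> 0 < norm (?M *v x)"
    then have "?M *v x = 0" by simp
    then obtain p where p: "p \<in> kernel_lattice A" "\<And>i. of_int (sgn (p $ i)) = sgn (x $ i)"
      by (rule lattice_vector_same_signs) blast
    have "0 \<le> p $ i" for i
    proof -
      have "0 \<le> sgn (x $ i)" using x by simp
      then have "0 \<le> real_of_int (sgn (p $ i))" by (simp only: p(2))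
      then show ?thesis by (auto simp: sgn_if split: if_splits)
    qed
    with p(1) assms have "p = 0" by blast
    then have "sgn (x $ i) = 0" for i using p(2)[of i] by simp
    then show False using x(2) by (simp add: vec_eq_iff sgn_zero_iff)
  qed
  have "?S = (\<Inter>i. {x. 0 \<le> x $ i})" by auto
  then have closed: "closed ?S"
    by (simp add: closed_Collect_le continuous_on_component closed_INT)
  have cont: "continuous_on UNIV (\<lambda>x. norm (?M *v x))"
    by (intro continuous_on_norm linear_continuous_on matrix_vector_mul_bounded_linear)
  obtain e where e: "0 < e" "\<And>x. x \<in> ?S \<Longrightarrow> e * norm x \<le> norm (?M *v x)"
    by (rule positive_on_cone_lower_bound[OF closed _ cont _ pos])
      (auto simp: matrix_vector_mult_scaleR)
  obtain N :: nat where N: "norm (real_vec b) / e \<le> real N"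
    using real_arch_simple by blast
  have "s $ i \<le> N" if s: "exp_degree A s = b" for s i
  proof -
    let ?x = "\<chi> i. real (s $ i)"
    have "real_of_int (\<Sum>i\<in>UNIV. A $ r $ i * int (s $ i)) = real_of_int (b $ r)" for r
      using s by (auto simp: exp_degree_def matrix_vector_mult_def)
    then have "?M *v ?x = real_vec b"
      by (simp add: vec_eq_iff matrix_vector_mult_def map_matrix_def)
    then have "e * norm ?x \<le> norm (real_vec b)" using e(2)[of ?x] by simp
    then have "norm ?x \<le> norm (real_vec b) / e" using e(1) by (simp add: field_simps)
    moreover have "real (s $ i) \<le> norm ?x" using component_le_norm_cart[of ?x i] by simp
    ultimately show ?thesis using N by linarith
  qed
  then have "(\<lambda>s. vec_nth s) ` {s. exp_degree A s = b} \<subseteq> (\<Pi>\<^sub>E i\<in>UNIV. {..N})"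
    by auto
  then have "finite ((\<lambda>s. vec_nth s) ` {s. exp_degree A s = b})"
    by (rule finite_subset) (auto intro: finite_PiE)
  then show ?thesis by (rule finite_imageD) (simp add: inj_on_def vec_nth_inject)
qed

section \<open>Toric ideals and circuit ideals\<close>

lemma circuit_ideal_le_toric_ideal: "circuit_ideal A \<subseteq> toric_ideal A"
  unfolding circuit_ideal_def toric_ideal_def
  by (intro ideal_gen_mono) (auto simp: circuit_def)

lemma binomial_homogeneous:
  assumes "u \<in> kernel_lattice A"
    and "s \<in> Poly_Mapping.keys (xmonom (pos_part u) - xmonom (neg_part u) :: ('n::finite, 'k::field) mpoly)"
  shows "exp_degree A s = exp_degree A (pos_part u)"
proof -
  have "s = pos_part u \<or> s = neg_part u"
    using assms(2) by (auto simp: xmonom_def in_keys_iff lookup_minus lookup_single when_def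
        split: if_splits)
  then show ?thesis using exp_degree_pos_neg[OF assms(1)] by auto
qed

text \<open>
  Both ideals are generated by homogeneous binomials, and the fibers of the multidegree are finite,
  so under the inclusion of initial ideals each generator of the toric ideal can be reduced to \<open>0\<close>
  modulo the circuit ideal.
\<close>

lemma toric_eq_circuit_if_initial_ideals_eq:
  fixes A :: "int^'n^'d"
  assumes pointed: "kernel_lattice A \<inter> {u. \<forall>i. 0 \<le> u $ i} = {0}"
    and ini: "initial_ideal w (toric_ideal A :: ('n, 'k::field) mpoly set) \<subseteq>
      initial_ideal w (circuit_ideal A)"
  shows "(toric_ideal A :: ('n, 'k) mpoly set) = circuit_ideal A"
proof
  let ?gen = "\<lambda>u. xmonom (pos_part u) - xmonom (neg_part u) :: ('n, 'k) mpoly"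
  have graded: "graded (exp_degree A) (circuit_ideal A :: ('n, 'k) mpoly set)"
    unfolding circuit_ideal_def
    by (rule graded_ideal_gen) (auto simp: exp_degree_add circuit_def dest: binomial_homogeneous)
  have "?gen u \<in> circuit_ideal A" if u: "u \<in> kernel_lattice A" for u
  proof -
    have "?gen u \<in> toric_ideal A"
      unfolding toric_ideal_def using u by (intro ideal_gen_base) blast
    moreover have "\<forall>s\<in>Poly_Mapping.keys (?gen u). exp_degree A s = exp_degree A (pos_part u)"
      using binomial_homogeneous[OF u] by blast
    ultimately show ?thesis
      using homogeneous_in_ideal_if_initial_ideal_le[OF graded[unfolded circuit_ideal_def]
          finite_fiber[OF pointed] circuit_ideal_le_toric_ideal[unfolded circuit_ideal_def toric_ideal_def]
          ini[unfolded circuit_ideal_def toric_ideal_def]]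
      by (simp only: circuit_ideal_def toric_ideal_def)
  qed
  then show "(toric_ideal A :: ('n, 'k) mpoly set) \<subseteq> circuit_ideal A"
    unfolding toric_ideal_def circuit_ideal_def by (intro ideal_gen_minimal) auto
qed (rule circuit_ideal_le_toric_ideal)

lemma weight_pos_minus_neg:
  "weight w (pos_part c) - weight w (neg_part c) = inner w (real_vec c)"
  unfolding weight_def inner_vec_def sum_subtractf[symmetric]
  by (intro sum.cong) (auto simp: pos_part_def neg_part_def max_def algebra_simps)

lemma pos_part_eq_neg_part: "pos_part c = neg_part c \<longleftrightarrow> c = 0"
  by (auto simp: vec_eq_iff pos_part_def neg_part_def max_def split: if_splits)

text \<open>
  If the weights of the two terms are equal, the initial form is the binomial itself, and both of
  its terms lie in the initial ideal because that is a monomial ideal.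
\<close>

lemma circuit_monomial_in_initial_ideal:
  fixes A :: "int^'n^'d"
  assumes mon: "monomial_ideal (initial_ideal w (circuit_ideal A :: ('n, 'k::field) mpoly set))"
    and c: "circuit A c" and w: "0 \<le> inner w (real_vec c)"
  shows "(xmonom (pos_part c) :: ('n, 'k) mpoly) \<in> initial_ideal w (circuit_ideal A)"
proof -
  let ?f = "xmonom (pos_part c) - xmonom (neg_part c) :: ('n, 'k) mpoly"
  have ne: "pos_part c \<noteq> neg_part c"
    using c by (simp add: pos_part_eq_neg_part circuit_def)
  have keys: "Poly_Mapping.keys ?f = {pos_part c, neg_part c}"
    using ne by (auto simp: xmonom_def in_keys_iff lookup_minus lookup_single when_def
        split: if_splits)
  have "?f \<in> circuit_ideal A"
    unfolding circuit_ideal_def using c by (intro ideal_gen_base) auto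
  then have "initial_form w ?f \<in> initial_ideal w (circuit_ideal A)"
    by (rule initial_form_in_initial_ideal)
  moreover have "pos_part c \<in> Poly_Mapping.keys (initial_form w ?f)"
    using weight_pos_minus_neg[of w c] w by (simp add: initial_form_eq_part keys_part keys)
  ultimately show ?thesis by (rule monomial_ideal_keys[OF mon])
qed

section \<open>The polyhedra of admissible pairs are polytopes\<close>

text \<open>
  A nonzero recession direction would yield a circuit \<open>c\<close> with positive part supported in \<open>\<sigma>\<close>
  and nonnegative weight. Then \<open>x\<^sup>u\<close> times the monomial of the positive part is not standard,
  against admissibility.
\<close>

lemma admissible_pair_recession_cone_trivial:
  fixes A :: "int^'n^'d" and x :: "real^'n"
  assumes mon: "monomial_ideal (initial_ideal w (circuit_ideal A :: ('n, 'k::field) mpoly set))"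
    and adm: "admissible_pair (initial_ideal w (circuit_ideal A :: ('n, 'k) mpoly set)) u \<sigma>"
    and x: "map_matrix real_of_int A *v x = 0" "\<And>i. i \<notin> \<sigma> \<Longrightarrow> x $ i \<le> 0" "0 \<le> inner w x"
  shows "x = 0"
proof (rule ccontr)
  assume "x \<noteq> 0"
  then obtain c where c: "circuit A c" "conformal c x" "0 \<le> inner w (real_vec c)"
    using x conformal_circuit_halfspace by blast
  have "c $ i \<le> 0" if "i \<notin> \<sigma>" for i
  proof (rule ccontr)
    assume "\<not> c $ i \<le> 0"
    then have "sgn (x $ i) = 1" using c(2)[unfolded conformal_def, rule_format, of i] by simp
    with x(2)[OF that] show False by (simp add: sgn_1_pos)
  qed
  then have "supp (pos_part c) \<subseteq> \<sigma>" by (force simp: supp_def pos_part_def)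
  moreover have "(xmonom u :: ('n, 'k) mpoly) * xmonom (pos_part c) \<in> initial_ideal w (circuit_ideal A)"
    using circuit_monomial_in_initial_ideal[OF mon c(1,3)]
    unfolding initial_ideal_def by (rule ideal_gen_mult)
  ultimately show False using adm by (auto simp: admissible_pair_def)
qed

lemma lookup_scaleR_poly_mapping:
  "Poly_Mapping.lookup (r *\<^sub>R z) j = r *\<^sub>R Poly_Mapping.lookup z j"
  for z :: "'a \<Rightarrow>\<^sub>0 'b::real_vector"
proof -
  have "finite {j. r *\<^sub>R Poly_Mapping.lookup z j \<noteq> 0}"
    by (rule finite_subset[OF _ finite_keys[of z]]) (auto simp: in_keys_iff)
  then show ?thesis by (simp add: scaleR_poly_mapping_def)
qed

text \<open>This is the vector \<open>B z\<close>.\<close>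

definition column_comb :: "nat \<Rightarrow> (nat \<Rightarrow> int^'n) \<Rightarrow> (nat \<Rightarrow>\<^sub>0 real) \<Rightarrow> real^'n" where
  "column_comb m B z = (\<Sum>j<m. Poly_Mapping.lookup z j *\<^sub>R real_vec (B j))"

lemma column_comb_nth:
  "column_comb m B z $ i = (\<Sum>j<m. real_of_int (B j $ i) * Poly_Mapping.lookup z j)"
  by (simp add: column_comb_def mult.commute)

lemma linear_column_comb: "linear (column_comb m B)"
  by (rule linearI) (simp_all add: column_comb_def lookup_add lookup_scaleR_poly_mapping
      scaleR_left_distrib sum.distrib scaleR_sum_right)

lemma Q_set_eq:
  "Q_set m B u w R = {z. Poly_Mapping.keys z \<subseteq> {..<m} \<and>
     (\<forall>i\<in>R. column_comb m B z $ i \<le> real (u $ i)) \<and> 0 \<le> inner w (column_comb m B z)}"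
proof -
  have "(\<Sum>j<m. - (\<Sum>i\<in>UNIV. w $ i * real_of_int (B j $ i)) * Poly_Mapping.lookup z j) =
      - inner w (column_comb m B z)" for z
    by (simp add: column_comb_def inner_sum_right inner_scaleR_right sum_negf mult.commute)
      (simp add: inner_vec_def)
  then show ?thesis by (simp add: Q_set_def column_comb_nth)
qed

lemma subspace_keys: "subspace {z :: 'a \<Rightarrow>\<^sub>0 real. Poly_Mapping.keys z \<subseteq> K}"
proof (rule subspaceI)
  fix x y :: "'a \<Rightarrow>\<^sub>0 real" and c :: real
  assume x: "x \<in> {z. Poly_Mapping.keys z \<subseteq> K}"
  have "Poly_Mapping.keys (c *\<^sub>R x) \<subseteq> Poly_Mapping.keys x"
    by (auto simp: in_keys_iff lookup_scaleR_poly_mapping)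
  with x show "c *\<^sub>R x \<in> {z. Poly_Mapping.keys z \<subseteq> K}" by auto
  assume "y \<in> {z. Poly_Mapping.keys z \<subseteq> K}"
  with x Poly_Mapping.keys_add[of x y] show "x + y \<in> {z. Poly_Mapping.keys z \<subseteq> K}" by blast
qed simp

text \<open>
  A real relation between the integral columns rounds to an integral one with the same signs, which
  is trivial by independence over the integers.
\<close>

lemma inj_on_column_comb:
  fixes B :: "nat \<Rightarrow> int^'n"
  assumes "\<And>c :: nat \<Rightarrow> int. (\<Sum>j<m. c j *s B j) = 0 \<Longrightarrow> \<forall>j<m. c j = 0"
  shows "inj_on (column_comb m B) {z. Poly_Mapping.keys z \<subseteq> {..<m}}"
proof (subst linear_inj_on_iff_eq_0[OF linear_column_comb subspace_keys], safe)
  fix z :: "nat \<Rightarrow>\<^sub>0 real"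
  assume z: "Poly_Mapping.keys z \<subseteq> {..<m}" "column_comb m B z = 0"
  obtain p where p: "\<And>j. j \<in> {..<m} \<Longrightarrow> of_int (sgn (p j)) = sgn (Poly_Mapping.lookup z j)"
    and sol: "\<And>i. i \<in> UNIV \<Longrightarrow> (\<Sum>j<m. B j $ i * p j) = 0"
    using integral_solution_same_signs[of "{..<m}" UNIV "\<lambda>i j. B j $ i" "Poly_Mapping.lookup z"] z(2)
    by (auto simp: vec_eq_iff column_comb_nth)
  have "(\<Sum>j<m. p j *s B j) = 0"
    using sol by (simp add: vec_eq_iff mult.commute)
  then have "\<forall>j<m. p j = 0" by (rule assms)
  then have "Poly_Mapping.lookup z j = 0" if "j < m" for j
    using p[of j] that by (simp add: sgn_zero_iff)
  moreover have "Poly_Mapping.lookup z j = 0" if "\<not> j < m" for j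
    using z(1) that by (auto simp: in_keys_iff subset_iff)
  ultimately show "z = 0"
    by (intro poly_mapping_eqI) (simp, blast)
qed

text \<open>
  A linear left inverse of \<open>z \<mapsto> B z\<close> maps the image of the set in \<open>\<real>\<^sup>n\<close> back to the set.
  This image is a polyhedron, and it is bounded because its recession cone is trivial.
\<close>

lemma polytope_Q_set:
  fixes A :: "int^'n^'d"
  assumes basis: "lattice_basis m B (kernel_lattice A)"
    and mon: "monomial_ideal (initial_ideal w (circuit_ideal A :: ('n, 'k::field) mpoly set))"
    and adm: "admissible_pair (initial_ideal w (circuit_ideal A :: ('n, 'k) mpoly set)) u \<sigma>"
  shows "polytope (Q_set m B u w (- \<sigma>))"
proof -
  let ?V = "{z :: nat \<Rightarrow>\<^sub>0 real. Poly_Mapping.keys z \<subseteq> {..<m}}"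
  let ?T = "column_comb m B"
  have "inj_on ?T ?V"
    by (rule inj_on_column_comb) (use basis in \<open>simp add: lattice_basis_def\<close>)
  from linear_exists_left_inverse_on[OF linear_column_comb subspace_keys this]
  obtain g where g: "linear g" "\<forall>z\<in>?V. g (?T z) = z" by metis
  define S where "S = ?T ` ?V"
  have sub: "subspace S"
    unfolding S_def by (intro linear_subspace_image linear_column_comb subspace_keys)
  have B_kernel: "B j \<in> kernel_lattice A" if "j < m" for j
  proof -
    have Bj: "B j = (\<Sum>k<m. (if k = j then 1 else 0) *s B k)"
      using that by (simp add: if_distrib[of "\<lambda>c. c *s _"] cong: if_cong)
    have "kernel_lattice A = {(\<Sum>k<m. c k *s B k) | c :: nat \<Rightarrow> int. True}"
      using basis by (simp add: lattice_basis_def)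
    then show ?thesis
      by (rule ssubst) (rule CollectI, rule exI, rule conjI[OF Bj TrueI])
  qed
  have S_kernel: "map_matrix real_of_int A *v x = 0" if x: "x \<in> S" for x
  proof -
    obtain z where "x = ?T z" using x unfolding S_def by blast
    then show ?thesis
      using B_kernel by (auto simp: column_comb_def matrix_vector_mult_scaleR real_kernel_real_vec
          linear_sum[OF matrix_vector_mul_linear] intro!: sum.neutral)
  qed
  define P where "P = S \<inter> (\<Inter>i\<in>-\<sigma>. {x. inner (axis i 1) x \<le> real (u $ i)}) \<inter> {x. 0 \<le> inner w x}"
  have P_iff: "x \<in> P \<longleftrightarrow> x \<in> S \<and> (\<forall>i\<in>-\<sigma>. x $ i \<le> real (u $ i)) \<and> 0 \<le> inner w x" for x
    by (auto simp: P_def inner_axis inner_commute)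
  have "polyhedron S"
    using sub by (intro affine_imp_polyhedron subspace_imp_affine)
  then have "polyhedron P"
    unfolding P_def by (intro polyhedron_Int polyhedron_Inter)
      (auto simp: polyhedron_halfspace_le polyhedron_halfspace_ge)
  moreover have "bounded P"
  proof -
    \<comment> \<open>\<open>f\<close> measures how far a vector is from satisfying the homogeneous inequalities.\<close>
    let ?f = "\<lambda>x. (\<Sum>i\<in>-\<sigma>. max (x $ i) 0) + max (- inner w x) 0"
    have pos: "0 < ?f x" if x: "x \<in> S" "x \<noteq> 0" for x
    proof -
      have nn: "0 \<le> (\<Sum>i\<in>-\<sigma>. max (x $ i) 0)" by (intro sum_nonneg) auto
      have "?f x \<noteq> 0"
      proof
        assume "?f x = 0"
        then have "(\<Sum>i\<in>-\<sigma>. max (x $ i) 0) = 0" "0 \<le> inner w x"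
          using nn by linarith+
        then have "\<forall>i\<in>-\<sigma>. x $ i \<le> 0" "0 \<le> inner w x"
          by (subst (asm) sum_nonneg_eq_0_iff; force)+
        then have "x = 0"
          using admissible_pair_recession_cone_trivial[OF mon adm S_kernel[OF x(1)]] by auto
        with x show False by simp
      qed
      with nn show ?thesis by linarith
    qed
    have homogeneous: "?f (t *\<^sub>R x) = t * ?f x" if "0 \<le> t" for t x
      using that by (simp add: max_mult_distrib_left distrib_left sum_distrib_left)
    have cont: "continuous_on UNIV ?f" by (intro continuous_intros)
    obtain e where e: "0 < e" "\<And>x. x \<in> S \<Longrightarrow> e * norm x \<le> ?f x"
      by (rule positive_on_cone_lower_bound[OF closed_subspace[OF sub] _ cont homogeneous pos])
        (auto intro: subspace_scale[OF sub])
    have "norm x \<le> (\<Sum>i\<in>-\<sigma>. real (u $ i)) / e" if x: "x \<in> P" for x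
    proof -
      have "e * norm x \<le> (\<Sum>i\<in>-\<sigma>. max (x $ i) 0)"
        using e(2)[of x] x by (simp add: P_iff)
      also have "\<dots> \<le> (\<Sum>i\<in>-\<sigma>. real (u $ i))"
        using x by (intro sum_mono) (simp add: P_iff)
      finally show ?thesis using e(1) by (simp add: field_simps)
    qed
    then show ?thesis unfolding bounded_iff by blast
  qed
  ultimately have "polytope P" by (simp add: polytope_eq_bounded_polyhedron)
  moreover have "Q_set m B u w (- \<sigma>) = g ` P"
  proof safe
    fix z assume "z \<in> Q_set m B u w (- \<sigma>)"
    then have "z \<in> ?V" "?T z \<in> P" by (auto simp: Q_set_eq P_iff S_def)
    then show "z \<in> g ` P" using g(2) by (metis image_eqI)
  next
    fix x assume "x \<in> P"
    moreover from this obtain z where "z \<in> ?V" "x = ?T z" by (auto simp: P_iff S_def)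
    ultimately show "g x \<in> Q_set m B u w (- \<sigma>)" using g(2) by (auto simp: Q_set_eq P_iff)
  qed
  ultimately show ?thesis using polytope_linear_image[OF g(1)] by simp
qed

section \<open>Existence of generic weights\<close>

text \<open>
  The weights for which some nonzero integral vector has weight \<open>0\<close> form a countable union of
  hyperplanes, hence a null set.
\<close>

lemma exists_weight_injective:
  obtains w :: "real^'n" where "inj (weight w)"
proof -
  let ?H = "\<lambda>u :: int^'n. {x :: real^'n. inner (real_vec u) x = 0}"
  have "negligible (\<Union>(?H ` (UNIV - {0})))"
  proof (rule negligible_countable_Union)
    fix T assume "T \<in> ?H ` (UNIV - {0})"
    then obtain u :: "int^'n" where u: "u \<noteq> 0" "T = ?H u" by blast
    then have "real_vec u \<noteq> 0" by (simp add: vec_eq_iff)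
    then show "negligible T" unfolding u by (intro negligible_hyperplane) simp
  qed simp
  then have "\<Union>(?H ` (UNIV - {0})) \<noteq> UNIV" using non_negligible_UNIV by metis
  then obtain w where w: "\<And>u :: int^'n. u \<noteq> 0 \<Longrightarrow> inner (real_vec u) w \<noteq> 0" by auto
  have "s = t" if "weight w s = weight w t" for s t
  proof (rule ccontr)
    let ?u = "\<chi> i. int (s $ i) - int (t $ i)"
    assume "s \<noteq> t"
    then have "?u \<noteq> 0" by (simp add: vec_eq_iff)
    from w[OF this] that show False
      by (simp add: weight_def inner_vec_def right_diff_distrib sum_subtractf mult.commute)
  qed
  then show ?thesis by (intro that injI)
qed

text \<open>
  The initial form of a nonzero polynomial has a single term here, whose coefficient is invertible.
\<close>

lemma monomial_initial_ideal:
  fixes I :: "('n::finite, 'k::field) mpoly set"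
  assumes inj: "inj (weight w)"
  shows "monomial_ideal (initial_ideal w I)"
  unfolding monomial_ideal_def
proof (intro exI equalityI)
  let ?U = "{s. (xmonom s :: ('n, 'k) mpoly) \<in> initial_ideal w I}"
  show "ideal_gen (xmonom ` ?U) \<subseteq> initial_ideal w I"
    unfolding initial_ideal_def by (intro ideal_gen_minimal) auto
  have "initial_form w f \<in> ideal_gen (xmonom ` ?U)" if f: "f \<in> I" for f
  proof (cases "f = 0")
    case True
    then show ?thesis by (simp add: ideal_gen_zero)
  next
    case False
    then obtain d where d: "\<exists>s\<in>Poly_Mapping.keys f. weight w s = d"
      "initial_form w f = part (\<lambda>s. weight w s = d) f"
      by (rule initial_form_top_weight) blast
    then obtain s where s: "s \<in> Poly_Mapping.keys f" "weight w s = d" by blast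
    let ?c = "Poly_Mapping.lookup f s"
    have ini: "initial_form w f = Poly_Mapping.single s ?c"
      unfolding d(2) using s(2) inj
      by (intro poly_mapping_eqI) (auto simp: lookup_part lookup_single when_def dest: injD)
    have "?c \<noteq> 0" using s(1) by (simp add: in_keys_iff)
    then have "xmonom s = Poly_Mapping.single 0 (1 / ?c) * initial_form w f"
      by (simp add: ini xmonom_def mult_single)
    then have "s \<in> ?U"
      using initial_form_in_initial_ideal[OF f, of w] unfolding initial_ideal_def
      by (auto intro: ideal_gen_mult)
    then show ?thesis
      unfolding ini by (subst term_eq_mult_xmonom) (intro ideal_gen_mult ideal_gen_base imageI)
  qed
  then show "initial_ideal w I \<subseteq> ideal_gen (xmonom ` ?U)"
    unfolding initial_ideal_def[of w I] by (intro ideal_gen_minimal) auto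
qed

lemma exists_generic:
  fixes A :: "int^'n^'d"
  obtains w where "generic TYPE('k::field) A w"
  using exists_weight_injective[where 'n = 'n] monomial_initial_ideal by (metis generic_def)

section \<open>CSP polytopes\<close>

text \<open>
  If the ideals differ, so do their initial ideals, and a standard monomial of the smaller one that
  the larger one contains is covered by a CSP. The set attached to it is automatically bounded.
\<close>

lemma exists_csp_polytope:
  fixes A :: "int^'n^'d"
  assumes pointed: "kernel_lattice A \<inter> {u. \<forall>i. 0 \<le> u $ i} = {0}"
    and basis: "lattice_basis (CARD('n) - CARD('d)) B (kernel_lattice A)"
    and gen: "generic TYPE('k::field) A w"
    and ne: "(toric_ideal A :: ('n, 'k) mpoly set) \<noteq> circuit_ideal A"
  obtains Q where "csp_polytope TYPE('k) A B w Q"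
proof -
  let ?M = "initial_ideal w (circuit_ideal A :: ('n, 'k) mpoly set)"
  let ?N = "initial_ideal w (toric_ideal A :: ('n, 'k) mpoly set)"
  have mon: "monomial_ideal ?M" "monomial_ideal ?N"
    using gen by (auto simp: generic_def)
  have "\<not> ?N \<subseteq> ?M"
    using ne toric_eq_circuit_if_initial_ideals_eq[OF pointed] by blast
  then obtain s where "xmonom s \<in> ?N" "xmonom s \<notin> ?M"
    using monomial_ideal_le[OF mon(2)] unfolding initial_ideal_def[of w "circuit_ideal A"] by blast
  then obtain u \<sigma> where "standard_pair ?M u \<sigma>" "\<not> standard_pair ?N u \<sigma>"
    using standard_pair_separates by metis
  then have "csp TYPE('k) A w u \<sigma>" "admissible_pair ?M u \<sigma>"
    by (simp_all add: csp_def standard_pair_def)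
  then have "csp_polytope TYPE('k) A B w (Q_set (CARD('n) - CARD('d)) B u w (- \<sigma>))"
    using polytope_Q_set[OF basis mon(1)] by (auto simp: csp_polytope_def)
  then show ?thesis by (rule that)
qed

theorem theorem3p20:
  fixes A :: "int^'n^'d" and B :: "nat \<Rightarrow> int^'n"
  assumes "rank (map_matrix real_of_int A) = CARD('d)"
    and "kernel_lattice A \<inter> {u. \<forall>i. 0 \<le> u $ i} = {0}"
    and "lattice_basis (CARD('n) - CARD('d)) B (kernel_lattice A)"
  shows "((toric_ideal A :: ('n, 'k::alg_closed_field) mpoly set) \<noteq> circuit_ideal A \<longleftrightarrow>
           (\<exists>w. generic TYPE('k) A w \<and> (\<exists>Q. csp_polytope TYPE('k) A B w Q))) \<and>
         ((\<exists>w. generic TYPE('k) A w \<and> (\<exists>Q. csp_polytope TYPE('k) A B w Q)) \<longleftrightarrow>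
           (\<forall>w. generic TYPE('k) A w \<longrightarrow> (\<exists>Q. csp_polytope TYPE('k) A B w Q)))"
proof -
  have eq: "(toric_ideal A :: ('n, 'k) mpoly set) \<noteq> circuit_ideal A"
    if "csp_polytope TYPE('k) A B w Q" for w Q
    using that by (auto simp: csp_polytope_def csp_def)
  obtain w where "generic TYPE('k) A w" by (rule exists_generic)
  then show ?thesis
    using eq exists_csp_polytope[OF assms(2,3)] by metis
qed

end
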